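(* Let $p$ be an odd prime, let $s,h,t,r$ be positive integers with $t\mid h$ and $s<h$, and let $q=p^h$. Assume that $a_{2rp^s-1}\in\mathbb{F}_{p^t}^*$ and $a_i\in\mathbb{F}_{p^t}^*$ for $1\le i\le rp^s-1$ are such that a polynomial of the form $g(x)=x^{2rp^s}+\sum_{i=1}^{2rp^s}a_ix^{2rp^s-i}\in\mathbb{F}_{p^t}[x]$ has $2rp^s$ distinct roots in $\mathbb{F}_q$, and let $\alpha_1,\dots,\alpha_{2rp^s}$ be all the roots of $g(x)$. Let $v_i\in\mathbb{F}_{q^2}$ be such that $v_i^2=(g'(\alpha_i))^{-1}$ for $1\le i\le2rp^s$ (such $v_i$ exist). Let $\boldsymbol{\alpha}=(\alpha_1,\dots,\alpha_{2rp^s})$ and $\boldsymbol{v}=(v_1,\dots,v_{2rp^s})$. Let $\eta_{rp^s}=2a_{2rp^s-1}^{-1}$ and $\eta_i=\eta_{rp^s}a_{rp^s-i}$ for $1\le i\le rp^s-1$. Set $$\mathcal{S}_2=\Big\{\sum_{i=0}^{rp^s-1}f_ix^i+2a_{2rp^s-1}^{-1}f_0\Big(\sum_{j=1}^{rp^s-1}a_jx^{2rp^s-1-j}+x^{2rp^s-1}\Big): f_i\in\mathbb{F}_{q^2}\text{ for }0\le i\le rp^s-1\Big\}.$$ Then $\mathcal{C}_2=ev_{\boldsymbol{\alpha},\boldsymbol{v}}(\mathcal{S}_2)$ is a $[2rp^s,\,rp^s]$ self-dual TGRS code over $\mathbb{F}_{q^2}$.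
   Context: The coefficients $a_i$ with $rp^s\le i\le 2rp^s$, $i\ne2rp^s-1$, are arbitrary elements of $\mathbb{F}_{p^t}$. For $\boldsymbol{\alpha}\in\mathbb{F}^n$ with distinct entries and $\boldsymbol{v}\in(\mathbb{F}^* )^n$ ($\mathbb{F}$ a finite field; here $\mathbb{F}=\mathbb{F}_{q^2}$), $ev_{\boldsymbol{\alpha},\boldsymbol{v}}(f)=(v_1f(\alpha_1),\dots,v_nf(\alpha_n))$ for $f\in\mathbb{F}[x]$. For a $k\times(n-k)$ matrix $(\eta_{ij})$ over $\mathbb{F}$, the twisted generalized Reed-Solomon (TGRS) code is the image under $ev_{\boldsymbol{\alpha},\boldsymbol{v}}$ of $\{\sum_{i=0}^{k-1}f_ix^i+\sum_{i=0}^{k-1}f_i\sum_{j=1}^{n-k}\eta_{i+1,j}x^{k-1+j}:f_i\in\mathbb{F}\}$. A linear code is $[n,k]$ if it has length $n$ and dimension $k$. It is self-dual if $\mathcal{C}=\mathcal{C}^\perp$ for the Euclidean inner product. *)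

theory Defs
  imports
    "HOL-Algebra.Algebraic_Closure_Type"
    "HOL-Analysis.Analysis"
    "HOL-Computational_Algebra.Polynomial"
begin

text \<open>
  Codes of length n over a finite field are subsets of \<^typ>\<open>'a ^ 'n\<close> with
  \<^term>\<open>CARD('n) = n\<close>. Linearity and dimension are those of the \<^typ>\<open>'a\<close>-vector space
  \<^typ>\<open>'a ^ 'n\<close>, that is \<^const>\<open>vec.subspace\<close> and \<^const>\<open>vec.dim\<close>.
\<close>

definition linear_code :: "nat \<Rightarrow> nat \<Rightarrow> ('a::{finite,field} ^ 'n) set \<Rightarrow> bool" where
  "linear_code n k C \<longleftrightarrow> CARD('n) = n \<and> vec.subspace C \<and> vec.dim C = k"

definition dual_code :: "('a::{finite,field} ^ 'n) set \<Rightarrow> ('a ^ 'n) set" where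
  "dual_code C = {y. \<forall>x\<in>C. scalar_product x y = 0}"

definition self_dual :: "('a::{finite,field} ^ 'n) set \<Rightarrow> bool" where
  "self_dual C \<longleftrightarrow> C = dual_code C"

definition ev :: "'a::{finite,field} ^ 'n \<Rightarrow> 'a ^ 'n \<Rightarrow> 'a poly \<Rightarrow> 'a ^ 'n" where
  "ev \<alpha> v f = (\<chi> i. v $ i * poly f (\<alpha> $ i))"

definition ev_params :: "'a::{finite,field} ^ 'n \<Rightarrow> 'a ^ 'n \<Rightarrow> bool" where
  "ev_params \<alpha> v \<longleftrightarrow> inj (($) \<alpha>) \<and> (\<forall>i. v $ i \<noteq> 0)"

text \<open>
  The twist matrix is a function on 1-based indices; only its values at row indices in
  {1..k} and column indices in {1..n-k} are used.
\<close>

definition tgrs_polys :: "nat \<Rightarrow> nat \<Rightarrow> (nat \<Rightarrow> nat \<Rightarrow> 'a::{finite,field}) \<Rightarrow> 'a poly set" where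
  "tgrs_polys n k H =
     {(\<Sum>i<k. monom (f i) i) +
      (\<Sum>i<k. smult (f i) (\<Sum>j=1..n-k. monom (H (i+1) j) (k - 1 + j))) | f. True}"

definition tgrs_code ::
  "nat \<Rightarrow> 'a::{finite,field} ^ 'n \<Rightarrow> 'a ^ 'n \<Rightarrow> (nat \<Rightarrow> nat \<Rightarrow> 'a) \<Rightarrow> ('a ^ 'n) set" where
  "tgrs_code k \<alpha> v H = ev \<alpha> v ` tgrs_polys CARD('n) k H"

definition is_tgrs_code :: "nat \<Rightarrow> ('a::{finite,field} ^ 'n) set \<Rightarrow> bool" where
  "is_tgrs_code k C \<longleftrightarrow>
     1 \<le> k \<and> k \<le> CARD('n) \<and> (\<exists>\<alpha> v H. ev_params \<alpha> v \<and> C = tgrs_code k \<alpha> v H)"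

end

theory Submission
  imports Defs
begin

text \<open>
  Since v_i^2 = 1 / g'(alpha_i), Lagrange interpolation gives
  <ev(F), ev(G)> = L(F G), where L vanishes on multiples of g and L(F) is the coefficient of
  x^(2k-1) in F if deg F < 2k. Let W = x^(2k-1) + sum_(1 <= j < k) a_j x^(2k-1-j), so that
  g = x W + R with deg R <= k. Then L(W) = 1, L(x^i W) = 0 for 1 <= i < k, and
  L(W^2) = - a_(2k-1). The factor 2 / a_(2k-1) of W in the twist is precisely the one that makes
  the code self-orthogonal. Conversely, a polynomial of degree < 2k orthogonal to the code
  is, modulo the code, a multiple c W, and pairing c W with 1 + (2 / a_(2k-1)) W gives - c = 0.
  The v_i exist because elements of F_q are squares in F_(q^2).
\<close>

subsection \<open>Lagrange interpolation\<close>

text \<open>The Lagrange basis polynomial at node \<open>i\<close> before normalisation, so it is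
  monic of degree n - 1.\<close>

definition omit_node :: "'a::field ^ 'n \<Rightarrow> 'n \<Rightarrow> 'a poly" where
  "omit_node \<alpha> i = (\<Prod>j\<in>-{i}. [:- \<alpha> $ j, 1:])"

lemma degree_omit_node: "degree (omit_node \<alpha> i) = CARD('n) - 1"
  for \<alpha> :: "'a::field ^ 'n"
  unfolding omit_node_def
  by (subst degree_prod_sum_eq) (auto simp: Compl_eq_Diff_UNIV card_Diff_singleton)

lemma coeff_omit_node: "poly.coeff (omit_node \<alpha> i) (CARD('n) - 1) = 1"
  for \<alpha> :: "'a::field ^ 'n"
  using lead_coeff_prod[of "\<lambda>j. [:- \<alpha> $ j, 1:]" "-{i}"]
  unfolding degree_omit_node[of \<alpha> i, symmetric] omit_node_def by simp

lemma poly_omit_node: "j \<noteq> i \<Longrightarrow> poly (omit_node \<alpha> i) (\<alpha> $ j) = 0"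
  for \<alpha> :: "'a::field ^ 'n"
  unfolding omit_node_def poly_prod by (rule prod_zero) auto

lemma poly_omit_node_self:
  "inj (($) \<alpha>) \<Longrightarrow> poly (omit_node \<alpha> i) (\<alpha> $ i) \<noteq> 0"
  for \<alpha> :: "'a::field ^ 'n"
  unfolding omit_node_def poly_prod by (auto simp: inj_def)

lemma eq_prod_of_roots:
  fixes \<alpha> :: "'a::field ^ 'n"
  assumes "inj (($) \<alpha>)" and "\<And>i. poly g (\<alpha> $ i) = 0"
    and "degree g = CARD('n)" and "lead_coeff g = 1"
  shows "g = (\<Prod>j\<in>UNIV. [:- \<alpha> $ j, 1:])"
proof (rule poly_eqI_degree_lead_coeff[where n = "CARD('n)" and A = "range (($) \<alpha>)"])
  have deg: "degree (\<Prod>j\<in>UNIV. [:- \<alpha> $ j, 1:]) = CARD('n)"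
    by (subst degree_prod_sum_eq) auto
  then show "degree (\<Prod>j\<in>UNIV. [:- \<alpha> $ j, 1:]) \<le> CARD('n)" by simp
  show "poly.coeff g CARD('n) = poly.coeff (\<Prod>j\<in>UNIV. [:- \<alpha> $ j, 1:]) CARD('n)"
    using lead_coeff_prod[of "\<lambda>j. [:- \<alpha> $ j, 1:]" UNIV] assms(3,4) deg by simp
  show "card (range (($) \<alpha>)) \<ge> CARD('n)"
    using card_image[OF assms(1)] by simp
qed (auto simp: assms poly_prod)

text \<open>By the product rule g' is the sum of all \<open>omit_node \<alpha> j\<close>, and at
  node \<open>i\<close> only the summand j = i survives.\<close>

lemma poly_pderiv_eq_omit_node:
  fixes \<alpha> :: "'a::field ^ 'n"
  assumes "inj (($) \<alpha>)" and "\<And>i. poly g (\<alpha> $ i) = 0"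
    and "degree g = CARD('n)" and "lead_coeff g = 1"
  shows "poly (pderiv g) (\<alpha> $ i) = poly (omit_node \<alpha> i) (\<alpha> $ i)"
proof -
  have "poly (pderiv g) (\<alpha> $ i) = (\<Sum>j\<in>UNIV. poly (omit_node \<alpha> j) (\<alpha> $ i))"
    unfolding eq_prod_of_roots[OF assms] pderiv_prod omit_node_def
    by (simp add: poly_sum Compl_eq_Diff_UNIV pderiv_pCons)
  also have "\<dots> = (\<Sum>j\<in>UNIV. if j = i then poly (omit_node \<alpha> i) (\<alpha> $ i) else 0)"
    by (intro sum.cong) (auto simp: poly_omit_node)
  finally show ?thesis by simp
qed

definition lagrange_poly :: "'a::field ^ 'n \<Rightarrow> 'a ^ 'n \<Rightarrow> 'a poly" where
  "lagrange_poly \<alpha> y =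
     (\<Sum>i\<in>UNIV. smult (y $ i / poly (omit_node \<alpha> i) (\<alpha> $ i)) (omit_node \<alpha> i))"

lemma degree_lagrange_poly: "degree (lagrange_poly \<alpha> y) < CARD('n)"
  for \<alpha> :: "'a::field ^ 'n"
proof -
  have "degree (lagrange_poly \<alpha> y) \<le> CARD('n) - 1"
    unfolding lagrange_poly_def
    by (intro degree_sum_le) (auto intro: order.trans[OF degree_smult_le] simp: degree_omit_node)
  moreover have "CARD('n) > 0" by simp
  ultimately show ?thesis by linarith
qed

lemma poly_lagrange_poly:
  fixes \<alpha> :: "'a::field ^ 'n"
  assumes "inj (($) \<alpha>)"
  shows "poly (lagrange_poly \<alpha> y) (\<alpha> $ i) = y $ i"
proof -
  have "poly (lagrange_poly \<alpha> y) (\<alpha> $ i) =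
      (\<Sum>j\<in>UNIV. if j = i then y $ i else 0)"
    unfolding lagrange_poly_def poly_sum
    using poly_omit_node_self[OF assms] by (intro sum.cong) (auto simp: poly_omit_node)
  then show ?thesis by simp
qed

lemma poly_eq_of_nodes:
  fixes \<alpha> :: "'a::field ^ 'n"
  assumes "inj (($) \<alpha>)" and "degree F < CARD('n)" and "degree G < CARD('n)"
    and "\<And>i. poly F (\<alpha> $ i) = poly G (\<alpha> $ i)"
  shows "F = G"
  by (rule poly_eqI_degree[where A = "range (($) \<alpha>)"]) (use assms card_image[OF assms(1)] in auto)

text \<open>Compare the top coefficients of F and of its Lagrange interpolation polynomial.\<close>

lemma sum_residues:
  fixes \<alpha> :: "'a::field ^ 'n"
  assumes "inj (($) \<alpha>)" and "\<And>i. poly g (\<alpha> $ i) = 0"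
    and "degree g = CARD('n)" and "lead_coeff g = 1" and "degree F < CARD('n)"
  shows "(\<Sum>i\<in>UNIV. inverse (poly (pderiv g) (\<alpha> $ i)) * poly F (\<alpha> $ i)) =
    poly.coeff F (CARD('n) - 1)"
proof -
  have "F = lagrange_poly \<alpha> (\<chi> i. poly F (\<alpha> $ i))"
    using assms by (intro poly_eq_of_nodes[of \<alpha>])
      (auto simp: poly_lagrange_poly degree_lagrange_poly)
  then have "poly.coeff F (CARD('n) - 1) =
      poly.coeff (lagrange_poly \<alpha> (\<chi> i. poly F (\<alpha> $ i))) (CARD('n) - 1)"
    by simp
  also have "\<dots> = (\<Sum>i\<in>UNIV. poly F (\<alpha> $ i) / poly (omit_node \<alpha> i) (\<alpha> $ i))"
    unfolding lagrange_poly_def coeff_sum coeff_smult coeff_omit_node by simp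
  finally show ?thesis
    by (simp add: poly_pderiv_eq_omit_node[OF assms(1-4)] field_simps)
qed

subsection \<open>Squares and subfields in finite fields\<close>

text \<open>Multiplication by \<open>y\<close> permutes the nonzero elements of \<open>K\<close>;
  comparing the products over both sides gives Fermat's identity. It serves both for subfields and
  for the whole field.\<close>

lemma power_card_minus_one_closed_set:
  fixes K :: "'a::{finite,field} set"
  assumes K: "0 \<in> K" "\<And>x y. x \<in> K \<Longrightarrow> y \<in> K \<Longrightarrow> x * y \<in> K"
    and y: "y \<in> K" "y \<noteq> 0"
  shows "y ^ (card K - 1) = 1"
proof -
  let ?U = "K - {0}"
  have inj: "inj_on ((*) y) ?U" using y by (auto simp: inj_on_def)
  have "(*) y ` ?U = ?U"
    by (rule card_subset_eq) (use y K card_image[OF inj] in auto)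
  then have "\<Prod>?U = (\<Prod>x\<in>?U. y * x)"
    using prod.reindex[OF inj, of "\<lambda>x. x"] by (simp add: o_def)
  also have "\<dots> = y ^ card ?U * \<Prod>?U" by (simp add: prod.distrib)
  finally have "y ^ card ?U = 1" by (simp add: prod_zero_iff)
  then show ?thesis using K by (simp add: card_Diff_singleton)
qed

lemma power_card_closed_set:
  fixes K :: "'a::{finite,field} set"
  assumes "0 \<in> K" "\<And>x y. x \<in> K \<Longrightarrow> y \<in> K \<Longrightarrow> x * y \<in> K" and "y \<in> K"
  shows "y ^ card K = y"
proof (cases "y = 0")
  case True
  then show ?thesis using assms(1) card_gt_0_iff[of K] by (auto simp: power_0_left)
next
  case False
  have "card K > 0" using assms(1) by (auto simp: card_gt_0_iff)
  then have "y ^ card K = y * y ^ (card K - 1)" by (metis Suc_diff_1 power_Suc)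
  then show ?thesis using power_card_minus_one_closed_set[OF assms False] by simp
qed

lemma card_roots_of_unity_le:
  assumes "m > 0"
  shows "card {x::'a::{finite,field}. x ^ m = 1} \<le> m"
proof -
  have "degree (monom (1::'a) m - 1) = m"
    using assms by (subst diff_conv_add_uminus, subst degree_add_eq_left) (auto simp: degree_monom_eq)
  moreover have "monom (1::'a) m - 1 \<noteq> 0"
    using assms calculation by force
  ultimately show ?thesis
    using card_poly_roots_bound[of "monom (1::'a) m - 1"] by (simp add: poly_monom)
qed

text \<open>A counting argument: squaring on the units has fibres of size at most 2, so there are at
  least \<open>?m\<close> nonzero squares. All of them are roots of x^m = 1, which has at most m
  roots, so every root is a square.\<close>

lemma euler_criterion:
  fixes y :: "'a::{finite,field}"
  assumes "odd CARD('a)" and "y ^ ((CARD('a) - 1) div 2) = 1"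
  shows "\<exists>x. x ^ 2 = y"
proof -
  let ?m = "(CARD('a) - 1) div 2" and ?U = "UNIV - {0::'a}"
  have "CARD('a) \<noteq> 1" using card_1_singletonE[of "UNIV::'a set"] zero_neq_one
    by (metis UNIV_I singletonD)
  then have m: "?m > 0" "2 * ?m = CARD('a) - 1" using assms(1) by (auto elim!: oddE)
  have U: "card ?U = 2 * ?m" using m(2) by (simp add: card_Diff_singleton)
  let ?S = "(\<lambda>x. x ^ 2) ` ?U"
  have sub: "?S \<subseteq> {x. x ^ ?m = 1}"
  proof
    fix y assume "y \<in> ?S"
    then obtain x where "x \<noteq> 0" "y = x ^ 2" by auto
    then show "y \<in> {x. x ^ ?m = 1}"
      using power_card_minus_one_closed_set[of UNIV x] m(2) by (simp flip: power_mult)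
  qed
  have "card ?U \<le> (\<Sum>y\<in>?S. card {x\<in>?U. x ^ 2 = y})"
    by (rule order.trans[OF card_mono card_UN_le]) auto
  also have "\<dots> \<le> (\<Sum>y\<in>?S. 2)"
  proof (rule sum_mono)
    fix y assume "y \<in> ?S"
    then obtain z where z: "y = z ^ 2" by auto
    have "{x\<in>?U. x ^ 2 = y} \<subseteq> {z, -z}" by (auto simp: z power2_eq_iff)
    then have "card {x\<in>?U. x ^ 2 = y} \<le> card {z, -z}" by (rule card_mono[rotated]) auto
    also have "\<dots> \<le> 2" by (simp add: card_insert_if)
    finally show "card {x\<in>?U. x ^ 2 = y} \<le> 2" .
  qed
  finally have "?m \<le> card ?S" using U by simp
  then have "?S = {x. x ^ ?m = 1}"
    using card_roots_of_unity_le[OF m(1), where 'a = 'a] card_mono[OF _ sub]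
    by (intro card_subset_eq[OF _ sub]) auto
  then show ?thesis using assms(2) by (metis (mono_tags, lifting) imageE mem_Collect_eq)
qed

section \<open>Subfields as fixed points of power maps\<close>

lemma subfield_closed:
  fixes K :: "'a::field set"
  assumes "subfield K (ring_of_type_algebra :: 'a ring)"
  shows "0 \<in> K" and "1 \<in> K" and "\<And>x y. x \<in> K \<Longrightarrow> y \<in> K \<Longrightarrow> x + y \<in> K"
    and "\<And>x y. x \<in> K \<Longrightarrow> y \<in> K \<Longrightarrow> x * y \<in> K"
proof -
  have "subring K (ring_of_type_algebra :: 'a ring)"
    using assms by (auto simp: subfield_def subdomain_def subcring_def)
  from subringE[OF this] show "0 \<in> K" and "1 \<in> K"
    and "\<And>x y. x \<in> K \<Longrightarrow> y \<in> K \<Longrightarrow> x + y \<in> K"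
    and "\<And>x y. x \<in> K \<Longrightarrow> y \<in> K \<Longrightarrow> x * y \<in> K"
    by (auto simp: ring_of_type_algebra_def)
qed

text \<open>The elements of \<open>K\<close> are roots of X^|K| - X, and this polynomial has at most
  |K| roots in the ambient field.\<close>

lemma subfield_eq_fixed_points:
  fixes K :: "'a::{finite,field} set"
  assumes "subfield K (ring_of_type_algebra :: 'a ring)"
  shows "K = {x. x ^ card K = x}"
proof (rule card_subset_eq)
  note c = subfield_closed[OF assms]
  show sub: "K \<subseteq> {x. x ^ card K = x}"
    using power_card_closed_set[OF c(1) c(4)] by blast
  have "card {0, 1::'a} \<le> card K" using c by (intro card_mono) auto
  then have K2: "card K \<ge> 2" by simp
  let ?P = "monom (1::'a) (card K) - monom 1 1"
  have deg: "degree ?P = card K"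
    using K2 by (subst diff_conv_add_uminus, subst degree_add_eq_left) (auto simp: degree_monom_eq)
  then have "?P \<noteq> 0" using K2 by (metis degree_0 not_numeral_le_zero)
  then have "card {x::'a. x ^ card K = x} \<le> card K"
    using card_poly_roots_bound[of ?P] deg by (simp add: poly_monom)
  then show "card K = card {x::'a. x ^ card K = x}"
    using sub card_mono[OF _ sub] by auto
qed simp

text \<open>Iterating x -> x^|K| m times still fixes \<open>K\<close>, and the fixed points of the
  iterate are \<open>L\<close>.\<close>

lemma subfield_mono:
  fixes K L :: "'a::{finite,field} set"
  assumes "subfield K (ring_of_type_algebra :: 'a ring)"
    and "subfield L (ring_of_type_algebra :: 'a ring)"
    and "card L = card K ^ m"
  shows "K \<subseteq> L"
proof
  fix x assume "x \<in> K"
  then have x: "x ^ card K = x" using subfield_eq_fixed_points[OF assms(1)] by blast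
  have "x ^ (card K ^ m) = x"
    by (induction m) (simp_all add: x power_mult mult.commute[of "card K"])
  then show "x \<in> L" using subfield_eq_fixed_points[OF assms(2)] assms(3) by simp
qed

lemma poly_pderiv_closed:
  fixes K :: "'a::field set"
  assumes K: "0 \<in> K" "1 \<in> K" "\<And>x y. x \<in> K \<Longrightarrow> y \<in> K \<Longrightarrow> x + y \<in> K"
      "\<And>x y. x \<in> K \<Longrightarrow> y \<in> K \<Longrightarrow> x * y \<in> K"
    and "\<And>i. poly.coeff g i \<in> K" and "x \<in> K"
  shows "poly (pderiv g) x \<in> K"
proof -
  \<comment> \<open>Differentiation multiplies coefficients by natural numbers, so these have to lie
    in \<open>K\<close> too.\<close>
  have nat: "of_nat m \<in> K" for m by (induction m) (auto intro: K)
  have pow: "x ^ m \<in> K" for m by (induction m) (auto intro: K assms)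
  have sum: "sum f A \<in> K" if "\<And>i. f i \<in> K" for f :: "nat \<Rightarrow> 'a" and A
    using that by (induction A rule: infinite_finite_induct) (auto intro: K)
  show ?thesis
    unfolding poly_altdef coeff_pderiv using assms nat pow by (intro sum K) auto
qed

text \<open>With q = |K|, the Euler exponent (q^2 - 1)/2 equals (q - 1)(q + 1)/2, a multiple of q -
  1, and y^(q-1) = 1 for nonzero \<open>y\<close> in \<open>K\<close>.\<close>

lemma square_in_quadratic_extension:
  fixes K :: "'a::{finite,field} set"
  assumes "subfield K (ring_of_type_algebra :: 'a ring)" and "CARD('a) = card K ^ 2"
    and "odd (card K)" and "y \<in> K"
  shows "\<exists>x. x ^ 2 = y"
proof (cases "y = 0")
  case False
  note c = subfield_closed[OF assms(1)]
  let ?q = "card K"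
  have y: "y ^ (?q - 1) = 1"
    using power_card_minus_one_closed_set[OF c(1) c(4) assms(4) False] .
  obtain m where m: "?q = 2 * m + 1" using assms(3) by (elim oddE)
  have "(CARD('a) - 1) div 2 = (?q - 1) * (m + 1)"
    unfolding assms(2) m by (simp add: power2_eq_square algebra_simps)
  then have "y ^ ((CARD('a) - 1) div 2) = 1" by (simp add: power_mult y del: One_nat_def)
  then show ?thesis using assms by (intro euler_criterion) auto
qed auto

subsection \<open>Self-duality of the twisted code\<close>

text \<open>Passes from independence of an indexed family to independence of its set of values, for
  which \<open>e\<close> must first be shown injective.\<close>

lemma finite_family_span:
  fixes e :: "nat \<Rightarrow> 'a::field ^ 'n"
  assumes ind: "\<And>f. (\<Sum>i<k. f i *s e i) = 0 \<Longrightarrow> \<forall>i<k. f i = 0"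
    and C: "C = {\<Sum>i<k. f i *s e i | f. True}"
  shows "vec.subspace C" and "vec.dim C = k"
proof -
  have inj: "inj_on e {..<k}"
  proof (rule inj_onI, rule ccontr)
    fix i j assume ij: "i \<in> {..<k}" "j \<in> {..<k}" "e i = e j" "i \<noteq> j"
    \<comment> \<open>A repeated vector would give the vanishing combination with coefficients 1 at
      \<open>i\<close> and -1 at \<open>j\<close>.\<close>
    have "(\<Sum>l<k. ((if l = i then 1 else 0) - (if l = j then 1 else 0)) *s e l) =
        (\<Sum>l<k. if l = i then e l else 0) - (\<Sum>l<k. if l = j then e l else 0)"
      unfolding sum_subtractf[symmetric] by (intro sum.cong) (auto simp: vec.scale_left_diff_distrib)
    also have "\<dots> = 0" using ij by simp
    finally show False using ind[of "\<lambda>l. (if l = i then 1 else 0) - (if l = j then 1 else 0)"] ij by auto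
  qed
  let ?B = "e ` {..<k}"
  have reidx: "(\<Sum>b\<in>?B. u b *s b) = (\<Sum>i<k. u (e i) *s e i)" for u
    by (simp add: sum.reindex[OF inj])
  have "vec.independent ?B"
  proof
    assume "vec.dependent ?B"
    then obtain u b where "b \<in> ?B" "u b \<noteq> 0" "(\<Sum>b\<in>?B. u b *s b) = 0"
      using vec.dependent_finite[of ?B] by auto
    then show False using ind[of "\<lambda>i. u (e i)"] unfolding reidx by auto
  qed
  moreover have "vec.span ?B = C"
  proof
    show "vec.span ?B \<subseteq> C"
      by (auto simp: vec.span_finite reidx C)
    show "C \<subseteq> vec.span ?B"
      unfolding C by (clarify, intro vec.span_sum vec.span_scale) (simp add: vec.span_base)
  qed
  ultimately show "vec.subspace C" "vec.dim C = k"
    using vec.subspace_span[of ?B] vec.dim_span_eq_card_independent[of ?B] card_image[OF inj] by auto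
qed

text \<open>Here \<open>k\<close> stands for r p^s. The condition \<open>v_sq\<close> turns inner
  products of evaluation vectors into the sums treated in \<open>sum_residues\<close>.\<close>

locale twisted_code =
  fixes k :: nat and a :: "nat \<Rightarrow> 'a::{finite,field}" and g :: "'a poly"
    and \<alpha> v :: "'a ^ 'n"
  assumes card_n: "CARD('n) = 2 * k" and k2: "2 \<le> k"
    and a_nz: "a (2 * k - 1) \<noteq> 0"
    and g: "g = monom 1 (2 * k) + (\<Sum>i=1..2 * k. monom (a i) (2 * k - i))"
    and inj: "inj (($) \<alpha>)" and roots: "\<And>i. poly g (\<alpha> $ i) = 0"
    and v_sq: "\<And>i. (v $ i) ^ 2 = inverse (poly (pderiv g) (\<alpha> $ i))"
begin

definition W :: "'a poly" where
  "W = (\<Sum>j=1..k - 1. monom (a j) (2 * k - 1 - j)) + monom 1 (2 * k - 1)"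

definition R :: "'a poly" where
  "R = (\<Sum>j=k..2 * k. monom (a j) (2 * k - j))"

definition low :: "(nat \<Rightarrow> 'a) \<Rightarrow> 'a poly" where
  "low f = (\<Sum>i=0..k - 1. monom (f i) i)"

definition twisted :: "(nat \<Rightarrow> 'a) \<Rightarrow> 'a poly" where
  "twisted f = low f + smult (2 * inverse (a (2 * k - 1)) * f 0) W"

definition L :: "'a poly \<Rightarrow> 'a" where
  "L F = (\<Sum>i\<in>UNIV. (v $ i) ^ 2 * poly F (\<alpha> $ i))"

section \<open>Coefficients and degrees of \<open>W\<close>, \<open>R\<close> and
  \<open>g\<close>\<close>

lemma coeff_W:
  "poly.coeff W m = (if m = 2 * k - 1 then 1
    else if m \<ge> k \<and> m < 2 * k - 1 then a (2 * k - 1 - m) else 0)"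
proof -
  have "poly.coeff (\<Sum>j=1..k - 1. monom (a j) (2 * k - 1 - j)) m =
      (\<Sum>j=1..k - 1. if j = 2 * k - 1 - m \<and> m < 2 * k - 1 then a j else 0)"
    unfolding coeff_sum coeff_monom by (intro sum.cong) auto
  also have "\<dots> = (if m \<ge> k \<and> m < 2 * k - 1 then a (2 * k - 1 - m) else 0)"
    by (cases "m < 2 * k - 1") auto
  finally show ?thesis by (auto simp: W_def)
qed

lemma coeff_R: "poly.coeff R m = (if m \<le> k then a (2 * k - m) else 0)"
proof -
  have "poly.coeff R m = (\<Sum>j=k..2 * k. if j = 2 * k - m \<and> m \<le> 2 * k then a j else 0)"
    unfolding R_def coeff_sum coeff_monom by (intro sum.cong) auto
  also have "\<dots> = (if m \<le> k then a (2 * k - m) else 0)"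
    by (cases "m \<le> 2 * k") auto
  finally show ?thesis .
qed

lemma coeff_g:
  "poly.coeff g m = (if m = 2 * k then 1 else if m < 2 * k then a (2 * k - m) else 0)"
proof -
  have "poly.coeff (\<Sum>i=1..2 * k. monom (a i) (2 * k - i)) m =
      (\<Sum>j=1..2 * k. if j = 2 * k - m \<and> m < 2 * k then a j else 0)"
    unfolding coeff_sum coeff_monom by (intro sum.cong) auto
  also have "\<dots> = (if m < 2 * k then a (2 * k - m) else 0)"
    by (cases "m < 2 * k") auto
  finally show ?thesis by (auto simp: g)
qed

lemma g_eq: "g = pCons 0 W + R"
proof (rule poly_eqI)
  fix m show "poly.coeff g m = poly.coeff (pCons 0 W + R) m"
    using k2 by (cases m) (auto simp: coeff_g coeff_W coeff_R coeff_pCons)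
qed

lemma degree_g: "degree g = 2 * k"
  by (rule order.antisym, rule degree_le, simp add: coeff_g, rule le_degree, simp add: coeff_g)

lemma degree_W: "degree W = 2 * k - 1"
  by (rule order.antisym, rule degree_le, simp add: coeff_W, rule le_degree, simp add: coeff_W)

lemma degree_R: "degree R \<le> k"
  by (rule degree_le) (simp add: coeff_R)

section \<open>The functional \<open>L\<close> and its values on \<open>W\<close>\<close>

lemma L_add: "L (F + G) = L F + L G"
  by (simp add: L_def distrib_left sum.distrib)

lemma L_smult: "L (smult c F) = c * L F"
  by (simp add: L_def sum_distrib_left mult.left_commute)

lemma L_diff: "L (F - G) = L F - L G"
  by (simp add: L_def right_diff_distrib sum_subtractf)

lemma L_sum: "L (sum F A) = (\<Sum>x\<in>A. L (F x))"
  by (induction A rule: infinite_finite_induct) (auto simp: L_add, simp_all add: L_def)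

lemma L_mult_g: "L (g * F) = 0"
  by (simp add: L_def roots)

lemma L_eq_coeff: "degree F < 2 * k \<Longrightarrow> L F = poly.coeff F (2 * k - 1)"
  using sum_residues[OF inj roots, of F] by (simp add: L_def v_sq card_n degree_g coeff_g)

lemma scalar_product_ev: "scalar_product (ev \<alpha> v F) (ev \<alpha> v G) = L (F * G)"
  by (simp add: scalar_product_def ev_def L_def power2_eq_square mult_ac)

lemma L_W: "L W = 1"
  using k2 by (simp add: L_eq_coeff degree_W coeff_W)

text \<open>Modulo \<open>g\<close>, x^i W = x^(i-1) (g - R) becomes -x^(i-1) R, whose degree is at
  most k + i - 1 < 2k - 1.\<close>

lemma L_monom_W:
  assumes "1 \<le> i" "i < k"
  shows "L (monom 1 i * W) = 0"
proof -
  obtain j where j: "i = Suc j" using assms by (cases i) auto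
  have "monom 1 i * W = monom 1 j * pCons 0 W" by (simp add: j monom_Suc)
  also have "\<dots> = g * monom 1 j - monom 1 j * R" by (simp add: g_eq algebra_simps)
  finally have "L (monom 1 i * W) = - L (monom 1 j * R)" by (simp add: L_diff L_mult_g)
  moreover have "degree (monom 1 j * R) \<le> j + k"
    using degree_mult_le[of "monom 1 j" R] degree_R by (simp add: degree_monom_eq)
  then have "degree (monom 1 j * R) < 2 * k - 1" using assms j by simp
  ultimately show ?thesis by (simp add: L_eq_coeff coeff_eq_0)
qed

text \<open>The remainder S of W^2 modulo g is determined by x^2 S = R^2 - (a (2 k) + a (2 k - 1) x) g.\<close>

lemma L_W_W: "L (W * W) = - a (2 * k - 1)"
proof -
  \<comment> \<open>Here R = c + x^2 T, and W = x W' because \<open>W\<close> has no constant term.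
    As x W = g - R, one gets x^2 W^2 = g (g - 2R) + R^2 with g - 2R = x^2 (W' - T) - c. Hence W' - T
    is the right multiplier of \<open>g\<close>.\<close>
  define c where "c = [:a (2 * k), a (2 * k - 1):]"
  define T where "T = poly_shift 2 R"
  define W' where "W' = poly_shift 1 W"
  define S where "S = W * W - g * (W' - T)"
  have W': "W = pCons 0 W'"
    by (rule poly_eqI) (use k2 in \<open>auto simp: W'_def coeff_pCons coeff_poly_shift coeff_W split: nat.split\<close>)
  have T: "R = c + pCons 0 (pCons 0 T)"
    by (rule poly_eqI)
      (use k2 in \<open>auto simp: T_def c_def coeff_pCons coeff_poly_shift coeff_R split: nat.split\<close>)
  let ?X = "pCons 0 1 :: 'a poly"
  have X: "pCons 0 F = ?X * F" for F by simp
  have "?X * (?X * S) = (?X * W) * (?X * W) - g * (?X * (?X * W')) + g * (?X * (?X * T))"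
    unfolding S_def by (simp only: algebra_simps)
  also have "?X * W = g - R" using g_eq by simp
  also have "?X * (?X * W') = g - R" using g_eq W' by simp
  also have "?X * (?X * T) = R - c" using T by simp
  finally have S: "pCons 0 (pCons 0 S) = R * R - c * g"
    by (simp add: algebra_simps)
  have dR: "degree (R * R) \<le> 2 * k"
    using degree_mult_le[of R R] degree_R by simp
  have coeff_c: "poly.coeff (c * g) (Suc (Suc m)) =
      a (2 * k) * poly.coeff g (Suc (Suc m)) + a (2 * k - 1) * poly.coeff g (Suc m)" for m
    by (simp add: c_def)
  have coeff_S: "poly.coeff S m =
      poly.coeff (R * R) (Suc (Suc m)) - poly.coeff (c * g) (Suc (Suc m))" for m
    using arg_cong[OF S, of "\<lambda>F. poly.coeff F (Suc (Suc m))"] by simp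
  have "degree S \<le> 2 * k - 1"
    by (rule degree_le) (use k2 dR in \<open>auto simp: coeff_S coeff_c coeff_g coeff_eq_0\<close>)
  then have "L S = poly.coeff S (2 * k - 1)" using k2 by (intro L_eq_coeff) auto
  \<comment> \<open>This is the coefficient of x^(2k+1) in R^2 - c g: R^2 has degree at most 2k, and
    the top term of c g is a_(2k-1) x^(2k+1).\<close>
  also have "\<dots> = - a (2 * k - 1)"
    using k2 dR coeff_c[of "2 * k - 1"] by (simp add: coeff_S coeff_g coeff_eq_0)
  finally have "L S = - a (2 * k - 1)" .
  then show ?thesis by (simp add: S_def L_diff L_mult_g)
qed

section \<open>Self-orthogonality of the twisted polynomials\<close>

lemma degree_low: "degree (low f) \<le> k - 1"
  unfolding low_def by (intro degree_sum_le) (auto intro: order.trans[OF degree_monom_le])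

lemma coeff_low: "poly.coeff (low f) m = (if m < k then f m else 0)"
  unfolding low_def coeff_sum coeff_monom using k2 by auto

text \<open>The product has degree at most 2k - 2, one short of the coefficient that
  \<open>L\<close> reads.\<close>

lemma L_low_low: "L (low f * low f') = 0"
proof -
  have "degree (low f * low f') \<le> (k - 1) + (k - 1)"
    using degree_mult_le[of "low f" "low f'"] degree_low[of f] degree_low[of f'] by linarith
  then have "degree (low f * low f') < 2 * k - 1" using k2 by simp
  then show ?thesis by (simp add: L_eq_coeff coeff_eq_0)
qed

lemma L_low_W: "L (low f * W) = f 0"
proof -
  have "low f * W = (\<Sum>i=0..k - 1. smult (f i) (monom 1 i * W))"
    unfolding low_def sum_distrib_right by (simp flip: mult_smult_left add: smult_monom)
  then have "L (low f * W) = (\<Sum>i=0..k - 1. f i * L (monom 1 i * W))"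
    by (simp add: L_sum L_smult)
  also have "\<dots> = (\<Sum>i=0..k - 1. if i = 0 then f 0 else 0)"
    using k2 by (intro sum.cong) (auto simp: L_monom_W L_W)
  finally show ?thesis by simp
qed

lemma twisted_unit:
  assumes "i < k"
  shows "twisted (\<lambda>j. if j = i then 1 else 0) =
    monom 1 i + (if i = 0 then smult (2 * inverse (a (2 * k - 1))) W else 0)"
proof -
  have "low (\<lambda>j. if j = i then 1 else 0) = monom 1 i"
    by (rule poly_eqI) (use assms in \<open>auto simp: coeff_low\<close>)
  then show ?thesis by (simp add: twisted_def)
qed

lemma L_twisted: "L (twisted f * F) =
     L (low f * F) + 2 * inverse (a (2 * k - 1)) * f 0 * L (W * F)"
  by (simp add: twisted_def distrib_right L_add L_smult)

text \<open>The untwisted part contributes f 0 and the twist -2 f 0; the constant 2 / a_(2k-1) is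
  what flips the sign.\<close>

lemma L_twisted_W: "L (twisted f * W) = - f 0"
  using a_nz by (simp add: L_twisted L_low_W L_W_W)

text \<open>The low part of the second factor contributes (2 / a_(2k-1)) f(0) f'(0), and by
  \<open>L_twisted_W\<close> its twist contributes the negative of this.\<close>

lemma L_twisted_twisted: "L (twisted f * twisted f') = 0"
proof -
  have "L (twisted f * low f') = L (low f * low f') + 2 * inverse (a (2 * k - 1)) * f 0 * L (low f' * W)"
    unfolding L_twisted by (simp add: mult.commute)
  moreover have "L (twisted f * twisted f') =
      L (twisted f * low f') + 2 * inverse (a (2 * k - 1)) * f' 0 * L (twisted f * W)"
    by (simp only: twisted_def[of f'] distrib_left mult_smult_right L_add L_smult)
  ultimately show ?thesis by (simp add: L_low_low L_low_W L_twisted_W)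
qed

lemma degree_twisted: "degree (twisted f) < 2 * k"
proof -
  have "degree (twisted f) \<le> 2 * k - 1"
    unfolding twisted_def using degree_low[of f] degree_W
    by (intro degree_add_le order.trans[OF degree_smult_le]) auto
  then show ?thesis using k2 by linarith
qed

text \<open>\<open>W\<close> starts only at degree k, so the message can be read off the low
  coefficients.\<close>

lemma coeff_twisted: "m < k \<Longrightarrow> poly.coeff (twisted f) m = f m"
  by (simp add: twisted_def coeff_low coeff_W)

lemma v_nz: "v $ i \<noteq> 0"
  using v_sq[of i] poly_omit_node_self[OF inj, of i] poly_pderiv_eq_omit_node[OF inj roots, of i]
  by (auto simp: degree_g card_n coeff_g)

text \<open>Subtracting the twisted polynomial with the same low coefficients leaves
  \<open>F0\<close> with terms only from degree k on; \<open>D\<close> also loses the term of degree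
  2k - 1.\<close>

lemma orthogonal_imp_twisted:
  assumes deg: "degree F < 2 * k" and orth: "\<And>f. L (twisted f * F) = 0"
  shows "F = twisted (poly.coeff F)"
proof -
  define F0 where "F0 = F - twisted (poly.coeff F)"
  define c where "c = poly.coeff F0 (2 * k - 1)"
  define D where "D = F0 - smult c W"
  have orth0: "L (twisted f * F0) = 0" for f
    by (simp add: F0_def right_diff_distrib L_diff orth L_twisted_twisted)
  have degF0: "degree F0 < 2 * k"
    unfolding F0_def using deg degree_twisted by (intro degree_diff_less) auto
  have "D = 0"
  proof (rule ccontr)
    assume "D \<noteq> 0"
    have nz: "poly.coeff D (degree D) \<noteq> 0" using \<open>D \<noteq> 0\<close> by simp
    have "degree D < 2 * k"
      unfolding D_def using degF0 degree_W k2
      by (intro degree_diff_less) (auto intro: le_less_trans[OF degree_smult_le])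
    moreover have "poly.coeff D (2 * k - 1) = 0" by (simp add: D_def c_def coeff_W)
    ultimately have up: "degree D < 2 * k - 1"
      using nz by (cases "degree D = 2 * k - 1") auto
    have "poly.coeff D m = 0" if "m < k" for m
      using that k2 by (simp add: D_def F0_def coeff_twisted coeff_W)
    then have "\<not> degree D < k" using nz by blast
    then have lo: "k \<le> degree D" by simp
    \<comment> \<open>Pairing \<open>D\<close> with x^i moves its leading coefficient to degree 2k -
      1, where \<open>L\<close> reads it. Since 1 <= i < k, the monomial x^i carries no twist and
      pairs to 0 with \<open>W\<close>.\<close>
    define i where "i = 2 * k - 1 - degree D"
    have i: "1 \<le> i" "i < k" "i + degree D = 2 * k - 1" using up lo k2 by (auto simp: i_def)
    then have "twisted (\<lambda>j. if j = i then 1 else 0) = monom 1 i"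
      using twisted_unit[of i] by simp
    then have "L (monom 1 i * F0) = 0" using orth0 by metis
    then have "L (monom 1 i * D) = 0"
      using L_monom_W[OF i(1,2)] by (simp add: D_def right_diff_distrib L_diff L_smult)
    moreover have "degree (monom 1 i * D) = 2 * k - 1"
      using \<open>D \<noteq> 0\<close> i by (subst degree_mult_eq) (auto simp: degree_monom_eq)
    moreover have "poly.coeff (monom 1 i * D) (2 * k - 1) = poly.coeff D (degree D)"
      unfolding i(3)[symmetric] coeff_monom_mult by simp
    ultimately show False using nz k2 by (simp add: L_eq_coeff)
  qed
  then have F0: "F0 = smult c W" by (simp add: D_def)
  \<comment> \<open>Any message with nonzero entry at 0 detects \<open>c\<close>, by
    \<open>L_twisted_W\<close>.\<close>
  have "c * L (twisted (\<lambda>_. 1) * W) = 0"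
    using orth0[of "\<lambda>_. 1"] by (simp add: F0 L_smult)
  then have "F0 = 0" by (simp add: F0 L_twisted_W)
  then show ?thesis by (simp add: F0_def)
qed

section \<open>Self-duality, dimension and TGRS form of the code\<close>

lemma ev_inj:
  assumes "ev \<alpha> v F = ev \<alpha> v G" "degree F < 2 * k" "degree G < 2 * k"
  shows "F = G"
  by (rule poly_eq_of_nodes[OF inj]) (use assms v_nz in \<open>auto simp: card_n ev_def vec_eq_iff\<close>)

lemma self_dual_twisted: "self_dual (ev \<alpha> v ` range twisted)"
  unfolding self_dual_def
proof
  show "ev \<alpha> v ` range twisted \<subseteq> dual_code (ev \<alpha> v ` range twisted)"
    by (auto simp: dual_code_def scalar_product_ev L_twisted_twisted)
  show "dual_code (ev \<alpha> v ` range twisted) \<subseteq> ev \<alpha> v ` range twisted"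
  proof
    fix y assume y: "y \<in> dual_code (ev \<alpha> v ` range twisted)"
    \<comment> \<open>Every vector is the evaluation vector of a polynomial of degree below 2k:
      interpolate after dividing by the multipliers.\<close>
    define F where "F = lagrange_poly \<alpha> (\<chi> i. y $ i / v $ i)"
    have ev: "ev \<alpha> v F = y"
      by (simp add: ev_def F_def poly_lagrange_poly[OF inj] vec_eq_iff v_nz)
    have "degree F < 2 * k" using degree_lagrange_poly card_n by (metis F_def)
    moreover have "L (twisted f * F) = 0" for f
      using y ev by (auto simp: dual_code_def simp flip: scalar_product_ev)
    ultimately have "F = twisted (poly.coeff F)" by (rule orthogonal_imp_twisted)
    then show "y \<in> ev \<alpha> v ` range twisted" using ev by blast
  qed
qed

text \<open>The images of the unit messages form a basis: a vanishing combination is the evaluation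
  of a twisted polynomial, which is 0 by \<open>ev_inj\<close>, so all its low coefficients
  vanish.\<close>

lemma linear_code_twisted: "linear_code (2 * k) k (ev \<alpha> v ` range twisted)"
proof -
  let ?e = "\<lambda>i. ev \<alpha> v (twisted (\<lambda>j. if j = i then 1 else 0))"
  have poly_twisted: "poly (twisted f) x =
      (\<Sum>i<k. f i * x ^ i) + 2 * inverse (a (2 * k - 1)) * f 0 * poly W x" for f x
  proof -
    have "{0..k - 1} = {..<k}" using k2 by auto
    then show ?thesis by (simp add: twisted_def low_def poly_sum poly_monom)
  qed
  have comb: "(\<Sum>i<k. f i *s ?e i) = ev \<alpha> v (twisted f)" for f
  proof -
    have poly_comb:
      "(\<Sum>i<k. f i * poly (twisted (\<lambda>j. if j = i then 1 else 0)) x) = poly (twisted f) x" for x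
    proof -
      have "(\<Sum>i<k. f i * poly (twisted (\<lambda>j. if j = i then 1 else 0)) x) =
          (\<Sum>i<k. f i * x ^ i + (if i = 0 then 2 * inverse (a (2 * k - 1)) * f 0 * poly W x else 0))"
        by (intro sum.cong) (auto simp: twisted_unit poly_monom algebra_simps)
      also have "\<dots> = poly (twisted f) x"
        unfolding sum.distrib poly_twisted using k2 by simp
      finally show ?thesis .
    qed
    have "(\<Sum>i<k. f i *s ?e i) $ l =
        v $ l * (\<Sum>i<k. f i * poly (twisted (\<lambda>j. if j = i then 1 else 0)) (\<alpha> $ l))" for l
      by (simp add: ev_def sum_component sum_distrib_left mult.left_commute)
    then show ?thesis by (simp add: vec_eq_iff ev_def poly_comb)
  qed
  have ind: "\<forall>i<k. f i = 0" if "(\<Sum>i<k. f i *s ?e i) = 0" for f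
  proof -
    have "ev \<alpha> v (twisted f) = ev \<alpha> v 0"
      using that unfolding comb by (simp add: ev_def vec_eq_iff)
    then have "twisted f = 0" using k2 degree_twisted by (intro ev_inj) auto
    then show ?thesis using coeff_twisted[of _ f] by simp
  qed
  have C: "ev \<alpha> v ` range twisted = {\<Sum>i<k. f i *s ?e i | f. True}"
    unfolding comb by auto
  show ?thesis
    unfolding linear_code_def using finite_family_span[where e = ?e and k = k, OF ind C] card_n by blast
qed

text \<open>Only the first row of the twist matrix is nonzero, so only f 0 is twisted. The
  substitution j -> k - j turns \<eta>_j x^(k-1+j) into \<eta>_k a_j x^(2k-1-j), and column k gives
  the top term of \<open>W\<close>.\<close>

lemma tgrs_polys_twisted:
  assumes \<eta>k: "\<eta> k = 2 * inverse (a (2 * k - 1))"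
    and \<eta>: "\<And>i. i \<in> {1..k - 1} \<Longrightarrow> \<eta> i = \<eta> k * a (k - i)"
  shows "tgrs_polys (2 * k) k (\<lambda>i j. if i = 1 then \<eta> j else 0) = range twisted"
proof -
  have "(\<Sum>j=1..k. monom (\<eta> j) (k - 1 + j)) =
      (\<Sum>j=1..k - 1. monom (\<eta> j) (k - 1 + j)) + monom (\<eta> k) (2 * k - 1)"
  proof -
    obtain l where l: "k = Suc l" using k2 by (cases k) auto
    show ?thesis by (simp add: l mult_2)
  qed
  also have "(\<Sum>j=1..k - 1. monom (\<eta> j) (k - 1 + j)) =
      (\<Sum>j=1..k - 1. monom (\<eta> k * a j) (2 * k - 1 - j))"
    by (rule sum.reindex_bij_witness[where i = "\<lambda>j. k - j" and j = "\<lambda>j. k - j"])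
      (use k2 in \<open>auto simp: \<eta>\<close>)
  finally have sum_\<eta>: "(\<Sum>j=1..k. monom (\<eta> j) (k - 1 + j)) = smult (\<eta> k) W"
    by (intro poly_eqI) (simp add: W_def coeff_sum sum_distrib_left distrib_left if_distrib cong: if_cong)
  have idx: "{0..k - 1} = {..<k}" using k2 by auto
  have "(\<Sum>i<k. monom (f i) i) + (\<Sum>i<k. smult (f i)
      (\<Sum>j=1..2 * k - k. monom (if i + 1 = 1 then \<eta> j else 0) (k - 1 + j))) = twisted f" for f
  proof -
    have "(\<Sum>i<k. smult (f i)
          (\<Sum>j=1..2 * k - k. monom (if i + 1 = 1 then \<eta> j else 0) (k - 1 + j))) =
        (\<Sum>i<k. if i = 0 then smult (\<eta> k * f 0) W else 0)"
      by (intro sum.cong) (auto simp: sum_\<eta>[simplified] mult.commute)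
    also have "\<dots> = smult (\<eta> k * f 0) W" using k2 by simp
    finally show ?thesis unfolding twisted_def low_def idx \<eta>k by simp
  qed
  then show ?thesis unfolding tgrs_polys_def by auto
qed

end

section \<open>The self-dual TGRS code and the existence of its multipliers\<close>

theorem theorem38:
  fixes p s h t r q k :: nat
    and Fq Fpt :: "'a::{finite,field} set"
    and a \<eta> :: "nat \<Rightarrow> 'a"
    and g :: "'a poly"
    and \<alpha> :: "'a ^ 'n"
    and S2 :: "'a poly set"
  assumes "prime p" and "odd p"
    and "s > 0" and "h > 0" and "t > 0" and "r > 0"
    and "t dvd h" and "s < h"
    and q: "q = p ^ h"
    and "CARD('a) = q ^ 2"
    and "subfield Fq (ring_of_type_algebra :: 'a ring)" and "card Fq = q"
    and "subfield Fpt (ring_of_type_algebra :: 'a ring)" and "card Fpt = p ^ t"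
    and k: "k = r * p ^ s"
    and "CARD('n) = 2 * k"
    and "\<forall>i\<in>{1..2 * k}. a i \<in> Fpt"
    and "a (2 * k - 1) \<noteq> 0"
    and "\<forall>i\<in>{1..k - 1}. a i \<noteq> 0"
    and g: "g = monom 1 (2 * k) + (\<Sum>i=1..2 * k. monom (a i) (2 * k - i))"
    and "card {x \<in> Fq. poly g x = 0} = 2 * k"
    and "bij_betw (($) \<alpha>) UNIV {x. poly g x = 0}"
    and "\<eta> k = 2 * inverse (a (2 * k - 1))"
    and "\<forall>i\<in>{1..k - 1}. \<eta> i = \<eta> k * a (k - i)"
    and S2: "S2 = {(\<Sum>i=0..k - 1. monom (f i) i) +
               smult (2 * inverse (a (2 * k - 1)) * f 0)
                 ((\<Sum>j=1..k - 1. monom (a j) (2 * k - 1 - j)) + monom 1 (2 * k - 1))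
             | f. True}"
  shows "(\<exists>v :: 'a ^ 'n. \<forall>i. (v $ i) ^ 2 = inverse (poly (pderiv g) (\<alpha> $ i))) \<and>
         (\<forall>v :: 'a ^ 'n. (\<forall>i. (v $ i) ^ 2 = inverse (poly (pderiv g) (\<alpha> $ i))) \<longrightarrow>
            (let C2 = ev \<alpha> v ` S2 in
              linear_code (2 * k) k C2 \<and>
              self_dual C2 \<and>
              is_tgrs_code k C2 \<and>
              ev_params \<alpha> v \<and>
              C2 = tgrs_code k \<alpha> v (\<lambda>i j. if i = 1 then \<eta> j else 0)))"
proof -
  note prime_p = assms(1) and odd_p = assms(2) and Fq = assms(11,12) and Fpt = assms(13,14)
    and card_n = assms(16) and bij = assms(22)
  have "p \<ge> 3" using prime_p odd_p prime_ge_2_nat[of p] by (cases "p = 2") auto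
  moreover have "p \<le> p ^ s"
    using self_le_power[of p s] \<open>s > 0\<close> prime_gt_0_nat[OF prime_p] by simp
  moreover have "p ^ s \<le> k" using \<open>r > 0\<close> by (simp add: k)
  ultimately have k2: "2 \<le> k" by linarith
  have inj: "inj (($) \<alpha>)" and roots: "poly g (\<alpha> $ i) = 0" for i
    using bij by (auto simp: bij_betw_def)
  have code_v: "twisted_code k a g \<alpha> v"
    if "\<forall>i. (v $ i) ^ 2 = inverse (poly (pderiv g) (\<alpha> $ i))" for v
    using card_n k2 assms(18) g inj roots that by unfold_locales auto
  \<comment> \<open>The entries of \<open>\<alpha>\<close> are all roots in the large field, and
    there are as many roots already in \<open>Fq\<close>; hence every \<open>\<alpha> $ i\<close>
    lies in \<open>Fq\<close>.\<close>
  have "card {x. poly g x = 0} = 2 * k"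
    using bij_betw_same_card[OF bij] card_n by simp
  then have "{x \<in> Fq. poly g x = 0} = {x. poly g x = 0}"
    using assms(21) by (intro card_subset_eq) auto
  then have \<alpha>_Fq: "\<alpha> $ i \<in> Fq" for i using roots by blast
  \<comment> \<open>Divisibility of h by t makes q a power of p^t, which places the coefficients of
    \<open>g\<close> in \<open>Fq\<close>.\<close>
  obtain m where "h = t * m" using \<open>t dvd h\<close> by (elim dvdE)
  then have "card Fq = card Fpt ^ m" by (simp add: Fq(2) Fpt(2) q power_mult)
  then have "Fpt \<subseteq> Fq" by (rule subfield_mono[OF Fpt(1) Fq(1)])
  note closed = subfield_closed[OF Fq(1)]
  have coeff_g: "poly.coeff g j \<in> Fq" for j
  proof -
    have sum_closed: "sum f A \<in> Fq" if "\<And>i. i \<in> A \<Longrightarrow> f i \<in> Fq" for f and A :: "nat set"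
      using that by (induction A rule: infinite_finite_induct) (auto intro: closed)
    then show ?thesis
      unfolding g coeff_add coeff_sum coeff_monom
      using assms(17) \<open>Fpt \<subseteq> Fq\<close> closed(1,2) by (intro closed(3) sum_closed) auto
  qed
  have "\<exists>x. x ^ 2 = inverse (poly (pderiv g) (\<alpha> $ i))" for i
  proof -
    have "poly (pderiv g) (\<alpha> $ i) \<in> Fq"
      by (rule poly_pderiv_closed[OF closed coeff_g \<alpha>_Fq])
    \<comment> \<open>The derivative value lies in \<open>Fq\<close>, so it is a square in the
      quadratic extension; the inverse of its root is the multiplier.\<close>
    then obtain x where "x ^ 2 = poly (pderiv g) (\<alpha> $ i)"
      using square_in_quadratic_extension[OF Fq(1)] assms(10) Fq(2) odd_p q by auto
    then show ?thesis by (metis power_inverse)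
  qed
  then obtain u where "\<And>i. u i ^ 2 = inverse (poly (pderiv g) (\<alpha> $ i))" by metis
  then have ex: "\<exists>v :: 'a ^ 'n. \<forall>i. (v $ i) ^ 2 = inverse (poly (pderiv g) (\<alpha> $ i))"
    by (intro exI[of _ "\<chi> i. u i"]) simp
  have main: "linear_code (2 * k) k C2 \<and> self_dual C2 \<and> is_tgrs_code k C2 \<and> ev_params \<alpha> v \<and>
      C2 = tgrs_code k \<alpha> v (\<lambda>i j. if i = 1 then \<eta> j else 0)"
    if v: "\<forall>i. (v $ i) ^ 2 = inverse (poly (pderiv g) (\<alpha> $ i))" and C2: "C2 = ev \<alpha> v ` S2" for v C2
  proof -
    interpret twisted_code k a g \<alpha> v by (rule code_v[OF v])
    have "S2 = range twisted" unfolding S2 twisted_def low_def W_def by auto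
    then have C2: "C2 = ev \<alpha> v ` range twisted" using C2 by simp
    have tgrs: "C2 = tgrs_code k \<alpha> v (\<lambda>i j. if i = 1 then \<eta> j else 0)"
      using tgrs_polys_twisted[of \<eta>] assms(23,24) by (simp add: C2 tgrs_code_def card_n)
    have params: "ev_params \<alpha> v" using inj v_nz by (simp add: ev_params_def)
    have "is_tgrs_code k C2"
      unfolding is_tgrs_code_def using tgrs params k2 card_n by auto
    moreover have "linear_code (2 * k) k C2" "self_dual C2"
      using linear_code_twisted self_dual_twisted by (simp_all add: C2)
    ultimately show ?thesis using tgrs params by (intro conjI)
  qed
  show ?thesis using ex main unfolding Let_def by blast
qed

end
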